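(* Let $p<q$ be prime numbers, let $G$ be a non-abelian group of order $pq$, and let $H$ be a subgroup of $G$ of order $p$. Then $$\mathrm{ict}(G,H)=\frac{1}{q-1}\sum_{\substack{1\le j\le q\\ (j,q)=1}}p^{\,t_j+k_j-1}.$$
   Context: A left transversal of $H$ in $G$ is a set consisting of exactly one element from each left coset of $H$ in $G$, the representative of the coset $H$ being the identity. Each left transversal $S$ carries the induced binary operation $\circ$ defined by $\{x\circ y\}=S\cap xyH$; two left transversals are isomorphic if there is a bijection between them preserving the induced operations. $\mathrm{ict}(G,H)$ is the number of isomorphism classes of left transversals of $H$ in $G$. The numbers $t_j,k_j$ are defined as follows, with $n=q$. For $j$ coprime to $n$, $j^{-1}$ denotes an inverse of $j$ modulo $n$, $o(j)$ the order of $j$ in the group $U_n$ of units of $\mathbb{Z}_n$, and $(\cdot,\cdot)$ the greatest common divisor. Put $k_1=n$, $t_1=0$. For $1<j\le n$ with $(j,n)=1$, put $k_j=\big|\{m\in\{1,\dots,n\}\mid m=1+ln/(n,j^{-1}-1)\text{ for some integer } l\ge0\}\big|$, and define $t_j$ by $k_j+t_j=\frac{1}{o(j)}\sum_{m=1}^{o(j)}k_{j^m}$, where the index $j^m$ is taken modulo $n$. *)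

theory Defs
  imports
    "HOL-Algebra.Left_Coset"
    "HOL-Number_Theory.Number_Theory"
    Complex_Main
begin

definition left_transversal :: "('a, 'b) monoid_scheme \<Rightarrow> 'a set \<Rightarrow> 'a set \<Rightarrow> bool" where
  "left_transversal G H S \<longleftrightarrow>
     S \<subseteq> carrier G \<and> (\<forall>C \<in> lcosets\<^bsub>G\<^esub> H. \<exists>!s. s \<in> S \<inter> C) \<and> \<one>\<^bsub>G\<^esub> \<in> S"

definition transversal_op ::
    "('a, 'b) monoid_scheme \<Rightarrow> 'a set \<Rightarrow> 'a set \<Rightarrow> 'a \<Rightarrow> 'a \<Rightarrow> 'a" where
  "transversal_op G H S x y = (THE z. S \<inter> ((x \<otimes>\<^bsub>G\<^esub> y) <#\<^bsub>G\<^esub> H) = {z})"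

definition transversal_iso ::
    "('a, 'b) monoid_scheme \<Rightarrow> 'a set \<Rightarrow> 'a set \<Rightarrow> 'a set \<Rightarrow> bool" where
  "transversal_iso G H S T \<longleftrightarrow>
     (\<exists>f. bij_betw f S T \<and>
        (\<forall>x\<in>S. \<forall>y\<in>S.
           f (transversal_op G H S x y) = transversal_op G H T (f x) (f y)))"

definition ict :: "('a, 'b) monoid_scheme \<Rightarrow> 'a set \<Rightarrow> nat" where
  "ict G H =
     card ({S. left_transversal G H S} //
       {(S, T). left_transversal G H S \<and> left_transversal G H T \<and> transversal_iso G H S T})"

(* Meaningful for 1 <= j <= n coprime to n. The division n div gcd is exact, and the gcd
   depends only on the class of the inverse modulo n. *)
definition k_num :: "nat \<Rightarrow> nat \<Rightarrow> nat" where
  "k_num n j =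
     (if j = 1 then n
      else card {m \<in> {1..n}. \<exists>l::nat.
             int m = 1 + int l * (int n div gcd (int n) (modular_inverse (int n) (int j) - 1))})"

(* Real-valued, so that neither the division by o(j) nor the subtraction of k_j truncates.
   The library's ord n j is the order of j in the group of units modulo n. *)
definition t_num :: "nat \<Rightarrow> nat \<Rightarrow> real" where
  "t_num n j =
     (if j = 1 then 0
      else (\<Sum>m = 1..ord n j. real (k_num n (j ^ m mod n))) / real (ord n j) - real (k_num n j))"

end

theory Submission
  imports Defs "HOL-Algebra.Group_Action" "HOL-Algebra.Sylow"
begin

text \<open>
  Write \<open>G = Q \<rtimes> H\<close> with \<open>Q = \<langle>g\<rangle>\<close> of order \<open>q\<close> and \<open>h g h\<inverse> = g\<^sup>\<chi>\<^sup>(\<^sup>h\<^sup>)\<close>,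
  where \<open>\<chi>\<close> is injective because \<open>G\<close> is not abelian. A left transversal is \<open>{g\<^sup>i f(i)}\<close>
  for a function \<open>f\<close> from the nonzero residues to \<open>H\<close>, and its operation on residues is
  \<open>i \<circ> j = i + \<chi>(f(i)) j\<close>. As \<open>p < q\<close>, two left translations have the same slope, so they
  differ by a nonzero translation of the residues. An isomorphism conjugates it into an affine map
  without fixed points, i.e. a translation, and hence is multiplication by a unit. So the isomorphism
  classes are the orbits of the units on functions. A unit \<open>u\<close> fixes \<open>p\<close> to the power
  \<open>(q - 1) / o(u)\<close> of them, and Burnside's lemma applies; for prime \<open>q\<close> this exponent is
  \<open>t\<^sub>u + k\<^sub>u - 1\<close>.
\<close>

subsection \<open>Arithmetic modulo a prime\<close>

lemma prime_coprime_less: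
  fixes q u :: nat
  assumes "prime q" "u \<in> {1..<q}"
  shows "coprime u q"
proof -
  have "\<not> q dvd u" using assms(2) by (auto dest: nat_dvd_not_less)
  then show ?thesis using prime_imp_coprime[OF assms(1)] by (metis coprime_commute)
qed

text \<open>For j other than 1 the inverse of j is not 1 modulo q, so the gcd is 1 and the step is
  q. Then l = 0 gives m = 1, and every larger l exceeds the range up to q.\<close>

lemma k_num_prime:
  assumes q: "prime q" and j: "j \<in> {1..<q}"
  shows "k_num q j = (if j = 1 then q else 1)"
proof (cases "j = 1")
  case False
  let ?v = "modular_inverse (int q) (int j)"
  have q1: "1 < int q" using prime_gt_1_nat[OF q] by simp
  have "coprime j q" by (rule prime_coprime_less[OF q j])
  then have inv: "[int j * ?v = 1] (mod int q)"
    using cong_modular_inverse1[of "int j" "int q"] by simp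
  have "\<not> int q dvd ?v - 1"
  proof
    assume "int q dvd ?v - 1"
    then have "[int j * ?v = int j * 1] (mod int q)"
      by (intro cong_scalar_left) (simp add: cong_iff_dvd_diff)
    with inv have "[int j = 1] (mod int q)" by (metis cong_sym cong_trans mult_1_right)
    then have "[j = 1] (mod q)" by (metis cong_int_iff of_nat_1)
    then show False using j False by (auto simp: cong_def)
  qed
  then have "coprime (int q) (?v - 1)"
    using q by (simp add: prime_imp_coprime)
  then have *: "int q div gcd (int q) (?v - 1) = int q" by simp
  have "{m \<in> {1..q}. \<exists>l::nat. int m = 1 + int l * int q} = {1}"
  proof -
    have "m = 1" if "m \<in> {1..q}" "int m = 1 + int l * int q" for m l
    proof (cases l)
      case (Suc l')
      have "int m = int (1 + l * q)" using that(2) by simp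
      then have "m = 1 + l * q" by (simp only: of_nat_eq_iff)
      with that(1) Suc show ?thesis by simp
    qed (use that in simp)
    moreover have "1 \<le> q" using prime_gt_0_nat[OF q] by simp
    ultimately show ?thesis by (auto intro: exI[of _ 0])
  qed
  with False * show ?thesis by (simp add: k_num_def)
qed (simp add: k_num_def)

text \<open>For j other than 1, t_j + k_j is the mean of k over the powers of j. With d the order of
  j, only the last of the d powers is 1, so the values are q once and 1 otherwise, with mean 1 + (q
  - 1) / d. For j = 1 both sides are q - 1.\<close>

lemma t_num_prime:
  assumes q: "prime q" and j: "j \<in> {1..<q}"
  shows "t_num q j + real (k_num q j) - 1 = real ((q - 1) div ord q j)"
proof (cases "j = 1")
  case True
  have "1 < q" by (rule prime_gt_1_nat[OF q])
  with True show ?thesis by (simp add: t_num_def k_num_def ord_1_right of_nat_diff)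
next
  case False
  have cj: "coprime j q" by (rule prime_coprime_less[OF q j])
  define d where "d = ord q j"
  have d: "d > 0" using cj by (simp add: d_def coprime_commute)
  have q1: "1 < q" by (rule prime_gt_1_nat[OF q])
  have k: "k_num q (j ^ m mod q) = (if m = d then q else 1)" if m: "m \<in> {1..d}" for m
  proof -
    have "coprime (j ^ m) q" using cj by simp
    then have "j ^ m mod q \<noteq> 0"
      using q by (metis coprime_commute coprime_absorb_left mod_0_imp_dvd not_prime_unit)
    then have mem: "j ^ m mod q \<in> {1..<q}" using q1 by simp
    have "j ^ m mod q = 1 \<longleftrightarrow> [j ^ m = 1] (mod q)" using q1 by (simp add: cong_def)
    also have "\<dots> \<longleftrightarrow> d dvd m" unfolding d_def by (rule ord_divides)
    also have "\<dots> \<longleftrightarrow> m = d" using m by (auto dest: dvd_imp_le)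
    finally show ?thesis using k_num_prime[OF q mem] by simp
  qed
  \<comment> \<open>By Fermat. The division on naturals is therefore exact and agrees with the real
    quotient.\<close>
  have "d dvd q - 1"
    using fermat_theorem[OF q, of j] cj q by (simp add: d_def flip: ord_divides)
      (metis One_nat_def coprime_commute coprime_absorb_left not_prime_unit)
  then have "real ((q - 1) div d) = (real q - 1) / real d"
    using q1 by (simp add: real_of_nat_div of_nat_diff)
  moreover have "(\<Sum>m = 1..d. real (k_num q (j ^ m mod q))) = real q + real d - 1"
  proof -
    have "(\<Sum>m = 1..d. real (k_num q (j ^ m mod q))) = (\<Sum>m = 1..d. if m = d then real q else 1)"
      using k by (intro sum.cong) auto
    also have "\<dots> = real q + (\<Sum>m \<in> {1..d} - {d}. 1)"
      using d by (simp add: sum.remove[of _ d])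
    finally show ?thesis using d by (simp add: of_nat_diff)
  qed
  ultimately show ?thesis
    using False d by (simp add: t_num_def d_def[symmetric] field_simps)
qed

section \<open>Bijections between twisted additions of residues\<close>

text \<open>The left translations of i + a(i) j are affine, and \<phi> conjugates them into those of
  the second operation. Those of i and j have equal slope, so one composed with the inverse of the
  other is translation by d = i - j. Its conjugate is a translation by some c, and since \<phi>
  fixes 0 it sends n d to n c, which covers all residues.\<close>

lemma affine_twisted_hom_linear:
  fixes q :: nat and a b \<phi> :: "nat \<Rightarrow> nat"
  assumes q: "prime q" and bij: "bij_betw \<phi> {..<q} {..<q}"
    and ca: "\<And>i. i < q \<Longrightarrow> coprime (a i) q" and cb: "\<And>i. i < q \<Longrightarrow> coprime (b i) q"
    and hom: "\<And>i j. i < q \<Longrightarrow> j < q \<Longrightarrow> \<phi> ((i + a i * j) mod q) = (\<phi> i + b (\<phi> i) * \<phi> j) mod q"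
    and ij: "i < q" "j < q" "i \<noteq> j" "a i = a j"
  obtains u where "u \<in> {1..<q}" "\<And>k. k < q \<Longrightarrow> \<phi> k = u * k mod q"
    "\<And>k. k < q \<Longrightarrow> [a k = b (\<phi> k)] (mod q)"
proof -
  have q0: "0 < q" and q1: "1 < q" using prime_gt_0_nat[OF q] prime_gt_1_nat[OF q] .
  have less: "\<phi> k < q" if "k < q" for k using bij that by (auto simp: bij_betw_def)
  have modless [simp]: "k mod q < q" for k using q0 by simp
  have inj: "k = l" if "\<phi> k = \<phi> l" "k < q" "l < q" for k l
    using bij that by (auto simp: bij_betw_def inj_on_def)
  have homc: "[\<phi> ((k + a k * l) mod q) = \<phi> k + b (\<phi> k) * \<phi> l] (mod q)" if "k < q" "l < q" for k l
    using hom[OF that] by (simp add: cong_def)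
  \<comment> \<open>At (0, 0) the law reads \<phi>(0) = \<phi>(0) + b(\<phi>(0)) \<phi>(0), where
    b(\<phi>(0)) is a unit.\<close>
  have phi0: "\<phi> 0 = 0"
  proof -
    have "[\<phi> 0 + b (\<phi> 0) * \<phi> 0 = \<phi> 0 + 0] (mod q)"
      using homc[OF q0 q0] by (simp add: cong_sym)
    then have "[b (\<phi> 0) * \<phi> 0 = b (\<phi> 0) * 0] (mod q)" by (simp only: cong_add_lcancel_nat mult_0_right)
    then have "[\<phi> 0 = 0] (mod q)" using cong_mult_lcancel_nat[OF cb[OF less[OF q0]]] by blast
    then show ?thesis using less[OF q0] by (simp add: cong_def)
  qed
  \<comment> \<open>With different slopes the two image translations would agree at a point z, found
    by inverting the difference of the slopes. At the preimage x of z the translations of i and j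
    would agree too, and their equal slopes would force i = j.\<close>
  have bij_eq: "[b (\<phi> i) = b (\<phi> j)] (mod q)"
  proof (rule ccontr)
    assume "\<not> [b (\<phi> i) = b (\<phi> j)] (mod q)"
    then have "\<not> int q dvd int (b (\<phi> i)) - int (b (\<phi> j))"
      by (simp add: cong_iff_dvd_diff flip: cong_int_iff)
    then have "coprime (int (b (\<phi> i)) - int (b (\<phi> j))) (int q)"
      using q by (simp add: prime_imp_coprime coprime_commute)
    then obtain w where w: "[(int (b (\<phi> i)) - int (b (\<phi> j))) * w = 1] (mod int q)"
      using cong_solve_coprime_int by blast
    define z where "z = nat (w * (int (\<phi> j) - int (\<phi> i)) mod int q)"
    have iz: "int z = w * (int (\<phi> j) - int (\<phi> i)) mod int q" using q0 by (simp add: z_def)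
    then have "z < q" using q0 by (metis of_nat_0_less_iff of_nat_less_iff pos_mod_bound)
    then obtain x where x: "x < q" "\<phi> x = z" using bij by (metis bij_betw_iff_bijections lessThan_iff)
    have "[(int (b (\<phi> i)) - int (b (\<phi> j))) * int z =
        (int (b (\<phi> i)) - int (b (\<phi> j))) * (w * (int (\<phi> j) - int (\<phi> i)))] (mod int q)"
      by (intro cong_scalar_left) (simp add: iz cong_def)
    also have "[(int (b (\<phi> i)) - int (b (\<phi> j))) * (w * (int (\<phi> j) - int (\<phi> i))) =
        1 * (int (\<phi> j) - int (\<phi> i))] (mod int q)"
      using cong_scalar_right[OF w] by (simp add: mult.assoc)
    finally have "[int (\<phi> i + b (\<phi> i) * z) = int (\<phi> j + b (\<phi> j) * z)] (mod int q)"
      by (simp add: cong_iff_dvd_diff algebra_simps)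
    then have "[\<phi> i + b (\<phi> i) * z = \<phi> j + b (\<phi> j) * z] (mod q)" by (simp only: cong_int_iff)
    then have "\<phi> ((i + a i * x) mod q) = \<phi> ((j + a j * x) mod q)"
      using hom[OF ij(1) x(1)] hom[OF ij(2) x(1)] x(2) by (simp add: cong_def)
    then have "(i + a i * x) mod q = (j + a j * x) mod q" using inj q0 by simp
    then have "[i = j] (mod q)" using ij(4) by (simp add: cong_def[symmetric] cong_add_rcancel_nat)
    then show False using ij by (simp add: cong_def)
  qed
  \<comment> \<open>This is i - j modulo q; adding q keeps the subtraction from truncating, here and
    for \<open>c\<close>.\<close>
  define d where "d = i + q - j"
  have jd: "[j + d = i] (mod q)" using ij by (simp add: d_def cong_def)
  have cd: "coprime d q"
  proof -
    have "\<not> q dvd d"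
    proof
      assume "q dvd d"
      then have "[j + d = j + 0] (mod q)" by (intro cong_add) (simp_all add: cong_0_iff)
      with jd have "[i = j] (mod q)" by (metis add_0_right cong_sym cong_trans)
      then show False using ij by (simp add: cong_def)
    qed
    then show ?thesis using q by (simp add: coprime_commute[of d] prime_imp_coprime)
  qed
  define c where "c = \<phi> i + q - \<phi> j"
  have jc: "[\<phi> j + c = \<phi> i] (mod q)" using less[OF ij(2)] by (simp add: c_def cong_def)
  text \<open>Two left translations with the same slope differ by a translation, and so do their
    conjugates under \<open>\<phi>\<close>.\<close>
  have shift: "[\<phi> ((y + d) mod q) = \<phi> (y mod q) + c] (mod q)" for y
  proof -
    obtain v where v: "[a j * v = 1] (mod q)"
      using cong_solve_coprime_nat[OF ca[OF ij(2)]] by auto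
    \<comment> \<open>The preimage of y under the left translation of j; the summand
      \<open>q * j\<close> prevents truncation.\<close>
    define x where "x = v * (y + q * j - j) mod q"
    have jq: "j \<le> q * j" using q0 by simp
    have "[a j * x = a j * v * (y + q * j - j)] (mod q)"
      by (simp add: x_def cong_def mod_mult_right_eq mult.assoc)
    also have "[a j * v * (y + q * j - j) = 1 * (y + q * j - j)] (mod q)"
      by (rule cong_scalar_right[OF v])
    finally have "[j + a j * x = j + (y + q * j - j)] (mod q)"
      by (simp add: cong_add_lcancel_nat)
    also have "j + (y + q * j - j) = y + q * j" using jq by linarith
    also have "[y + q * j = y] (mod q)" by (simp add: cong_def)
    finally have Lj: "[j + a j * x = y] (mod q)" .
    have "[i + a i * x = j + d + a j * x] (mod q)"
      using cong_add[OF cong_sym[OF jd] cong_refl[of "a j * x"]] ij(4) by simp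
    also have "[j + d + a j * x = y + d] (mod q)"
      using cong_add[OF Lj cong_refl[of d]] by (simp add: ac_simps)
    finally have Li: "[i + a i * x = y + d] (mod q)" .
    have x: "x < q" using q0 by (simp add: x_def)
    have "[\<phi> ((y + d) mod q) = \<phi> i + b (\<phi> i) * \<phi> x] (mod q)"
      using homc[OF ij(1) x] Li by (simp add: cong_def)
    also have "[\<phi> i + b (\<phi> i) * \<phi> x = (\<phi> j + c) + b (\<phi> j) * \<phi> x] (mod q)"
      by (intro cong_add cong_sym[OF jc] cong_scalar_right bij_eq)
    also have "(\<phi> j + c) + b (\<phi> j) * \<phi> x = (\<phi> j + b (\<phi> j) * \<phi> x) + c" by simp
    also have "[(\<phi> j + b (\<phi> j) * \<phi> x) + c = \<phi> (y mod q) + c] (mod q)"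
      using cong_sym[OF homc[OF ij(2) x]] Lj by (intro cong_add cong_refl) (simp add: cong_def)
    finally show ?thesis .
  qed
  have mult: "[\<phi> (n * d mod q) = n * c] (mod q)" for n
  proof (induction n)
    case (Suc n)
    have "[\<phi> (Suc n * d mod q) = \<phi> (n * d mod q) + c] (mod q)"
      using shift[of "n * d"] by (simp add: add.commute)
    also have "[\<phi> (n * d mod q) + c = n * c + c] (mod q)" using Suc by (rule cong_add) simp
    finally show ?case by (simp add: add.commute)
  qed (simp add: phi0)
  \<comment> \<open>As d is a unit, every k is the multiple (k e) d, so the values on multiples of d
    determine \<phi>.\<close>
  obtain e where e: "[d * e = 1] (mod q)" using cong_solve_coprime_nat[OF cd] by auto
  define u where "u = e * c mod q"
  have lin: "\<phi> k = u * k mod q" if k: "k < q" for k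
  proof -
    have "[k * e * d = k * 1] (mod q)"
      using cong_scalar_left[OF e, of k] by (simp add: ac_simps)
    then have "k * e * d mod q = k" using k by (simp add: cong_def)
    with mult[of "k * e"] have "[\<phi> k = k * e * c] (mod q)" by simp
    then have "\<phi> k = k * e * c mod q" using less[OF k] by (simp add: cong_def)
    also have "k * e * c = e * c * k" by (simp add: ac_simps)
    also have "e * c * k mod q = u * k mod q" by (simp add: u_def mod_mult_left_eq)
    finally show ?thesis .
  qed
  have "u \<noteq> 0"
  proof
    assume "u = 0"
    then have "\<phi> 1 = \<phi> 0" using lin[OF q1] phi0 by simp
    then show False using inj[OF _ q1 q0] by simp
  qed
  then have u: "u \<in> {1..<q}" using q0 by (simp add: u_def)
  have cu: "coprime u q" by (rule prime_coprime_less[OF q u])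
  have "[a k = b (\<phi> k)] (mod q)" if k: "k < q" for k
  proof -
    \<comment> \<open>The value of \<phi> at k + a(k) is computed by linearity and by the law with
      second argument 1; then u k and the unit u cancel.\<close>
    have "[u * k + u * a k = u * ((k + a k * 1) mod q)] (mod q)"
      by (simp add: cong_def mod_mult_right_eq algebra_simps)
    also have "[u * ((k + a k * 1) mod q) = \<phi> ((k + a k * 1) mod q)] (mod q)"
      by (subst lin) (simp_all add: cong_def)
    also have "[\<phi> ((k + a k * 1) mod q) = \<phi> k + b (\<phi> k) * \<phi> 1] (mod q)" by (rule homc[OF k q1])
    also have "[\<phi> k + b (\<phi> k) * \<phi> 1 = u * k + b (\<phi> k) * u] (mod q)"
      unfolding lin[OF q1] lin[OF k] by (intro cong_add cong_scalar_left) (simp_all add: cong_def)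
    finally have "[u * a k = u * b (\<phi> k)] (mod q)"
      by (simp add: cong_add_lcancel_nat mult.commute)
    then show ?thesis using cu by (simp add: cong_mult_lcancel_nat)
  qed
  with u lin show ?thesis by (rule that)
qed

subsection \<open>Counting functions up to scaling\<close>

text \<open>Serves to pass from isomorphism classes of transversals to classes of functions. The set
  related to x is mapped onto the set related to its image, and an injection keeps distinct subsets
  of A distinct.\<close>

lemma card_quotient_bij_betw:
  assumes bij: "bij_betw \<Phi> A B" and "R \<subseteq> A \<times> A" "R' \<subseteq> B \<times> B"
    and rel: "\<And>x y. x \<in> A \<Longrightarrow> y \<in> A \<Longrightarrow> (x, y) \<in> R \<longleftrightarrow> (\<Phi> x, \<Phi> y) \<in> R'"
  shows "card (A // R) = card (B // R')"
proof (rule bij_betw_same_card)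
  have sub: "X \<subseteq> A" if "X \<in> A // R" for X
    using that assms(2) by (auto simp: quotient_def)
  have img: "\<Phi> ` (R `` {x}) = R' `` {\<Phi> x}" if "x \<in> A" for x
  proof
    show "\<Phi> ` (R `` {x}) \<subseteq> R' `` {\<Phi> x}"
      using rel that assms(2) by auto
    show "R' `` {\<Phi> x} \<subseteq> \<Phi> ` (R `` {x})"
    proof
      fix z assume "z \<in> R' `` {\<Phi> x}"
      then have "(\<Phi> x, z) \<in> R'" "z \<in> B" using assms(3) by auto
      moreover obtain y where "y \<in> A" "z = \<Phi> y"
        using bij \<open>z \<in> B\<close> by (auto simp: bij_betw_def)
      ultimately show "z \<in> \<Phi> ` (R `` {x})" using rel that by auto
    qed
  qed
  have "inj_on ((`) \<Phi>) (A // R)"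
    using sub bij by (intro inj_onI) (meson bij_betw_imp_inj_on inj_on_image_eq_iff)
  moreover have "(`) \<Phi> ` (A // R) = B // R'"
  proof -
    have "(`) \<Phi> ` (A // R) = (\<lambda>x. \<Phi> ` (R `` {x})) ` A"
      by (auto simp: quotient_def)
    also have "\<dots> = (\<lambda>x. R' `` {\<Phi> x}) ` A"
      using img by (intro image_cong) auto
    also have "\<dots> = (\<lambda>y. R' `` {y}) ` (\<Phi> ` A)" by auto
    also have "\<Phi> ` A = B" using bij by (simp add: bij_betw_def)
    finally show ?thesis by (auto simp: quotient_def)
  qed
  ultimately show "bij_betw ((`) \<Phi>) (A // R) (B // R')"
    by (simp add: bij_betw_def)
qed

text \<open>Functions constant on classes amount to functions on the quotient. This will count the
  functions fixed by a unit.\<close>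

lemma card_PiE_respecting:
  assumes R: "equiv A R" and "finite A"
  shows "card {f \<in> A \<rightarrow>\<^sub>E B. \<forall>(i, j) \<in> R. f i = f j} = card B ^ card (A // R)"
proof -
  let ?\<Psi> = "\<lambda>F. \<lambda>i\<in>A. F (R `` {i})"
  have "bij_betw ?\<Psi> ((A // R) \<rightarrow>\<^sub>E B) {f \<in> A \<rightarrow>\<^sub>E B. \<forall>(i, j) \<in> R. f i = f j}"
  proof (rule bij_betw_imageI)
    show "inj_on ?\<Psi> ((A // R) \<rightarrow>\<^sub>E B)"
    proof (rule inj_onI)
      fix F F' assume F: "F \<in> (A // R) \<rightarrow>\<^sub>E B" "F' \<in> (A // R) \<rightarrow>\<^sub>E B" "?\<Psi> F = ?\<Psi> F'"
      have "F X = F' X" if "X \<in> A // R" for X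
      proof -
        from that obtain i where "i \<in> A" "X = R `` {i}" by (auto elim: quotientE)
        with fun_cong[OF F(3), of i] show ?thesis by simp
      qed
      with F show "F = F'" by (intro PiE_ext) auto
    qed
    show "?\<Psi> ` ((A // R) \<rightarrow>\<^sub>E B) = {f \<in> A \<rightarrow>\<^sub>E B. \<forall>(i, j) \<in> R. f i = f j}"
    proof
      show "?\<Psi> ` ((A // R) \<rightarrow>\<^sub>E B) \<subseteq> {f \<in> A \<rightarrow>\<^sub>E B. \<forall>(i, j) \<in> R. f i = f j}"
        using equiv_class_eq[OF R] equiv_type[OF R]
        by (auto simp: quotientI PiE_iff)
    next
      show "{f \<in> A \<rightarrow>\<^sub>E B. \<forall>(i, j) \<in> R. f i = f j} \<subseteq> ?\<Psi> ` ((A // R) \<rightarrow>\<^sub>E B)"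
      proof clarify
        fix f assume f: "f \<in> A \<rightarrow>\<^sub>E B" and inv: "\<forall>(i, j) \<in> R. f i = f j"
        \<comment> \<open>On a class the image of f is a singleton, so \<open>the_elem\<close>
          yields the common value.\<close>
        define F where "F = (\<lambda>X\<in>A // R. the_elem (f ` X))"
        have *: "f ` (R `` {i}) = {f i}" if "i \<in> A" for i
        proof -
          have "f j = f i" if "(i, j) \<in> R" for j using inv that by auto
          moreover have "i \<in> R `` {i}" using \<open>i \<in> A\<close> by (rule equiv_class_self[OF R])
          ultimately show ?thesis by blast
        qed
        then have **: "F (R `` {i}) = f i" if "i \<in> A" for i
          using that by (simp add: F_def quotientI)
        have "F \<in> (A // R) \<rightarrow>\<^sub>E B"
        proof (rule PiE_I)
          fix X assume "X \<in> A // R"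
          then obtain i where "i \<in> A" "X = R `` {i}" by (auto elim: quotientE)
          then show "F X \<in> B" using ** f by auto
        qed (simp add: F_def)
        moreover have "f = ?\<Psi> F"
          using f ** by (auto simp: fun_eq_iff PiE_iff extensional_def)
        ultimately show "f \<in> ?\<Psi> ` ((A // R) \<rightarrow>\<^sub>E B)" by blast
      qed
    qed
  qed
  then have "card {f \<in> A \<rightarrow>\<^sub>E B. \<forall>(i, j) \<in> R. f i = f j} = card ((A // R) \<rightarrow>\<^sub>E B)"
    by (simp add: bij_betw_same_card)
  also have "\<dots> = card B ^ card (A // R)"
    using \<open>finite A\<close> R by (simp add: card_PiE finite_quotient equiv_type)
  finally show ?thesis .
qed

section \<open>Cosets of the subgroup generated by a unit\<close>

text \<open>For a unit u the classes are the cosets of the cyclic group generated by u. Natural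
  exponents reach the inverses too, since u has finite order.\<close>

definition power_rel :: "nat \<Rightarrow> nat \<Rightarrow> (nat \<times> nat) set" where
  "power_rel q u = {(i, j) \<in> {1..<q} \<times> {1..<q}. \<exists>m. j = u ^ m * i mod q}"

lemma mult_mod_prime_mem:
  fixes q a b :: nat
  assumes "prime q" "coprime a q" "b \<in> {1..<q}"
  shows "a * b mod q \<in> {1..<q}"
proof -
  have "coprime (a * b) q" using assms prime_coprime_less by simp
  then have "a * b mod q \<noteq> 0"
    using assms(1) by (metis coprime_commute coprime_absorb_left mod_0_imp_dvd not_prime_unit)
  then show ?thesis using assms(1) by (simp add: prime_gt_0_nat)
qed

text \<open>The powers of u with exponent below the order are distinct, exhaust all powers, and stay
  distinct after multiplication by the unit i.\<close>

lemma card_power_class: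
  assumes q: "prime q" and u: "u \<in> {1..<q}" and i: "i \<in> {1..<q}"
  shows "card (power_rel q u `` {i}) = ord q u"
proof -
  have cu: "coprime u q" and ci: "coprime i q" using prime_coprime_less q u i by auto
  have "power_rel q u `` {i} = (\<lambda>m. u ^ m * i mod q) ` {..<ord q u}"
  proof
    show "power_rel q u `` {i} \<subseteq> (\<lambda>m. u ^ m * i mod q) ` {..<ord q u}"
    proof
      fix j assume "j \<in> power_rel q u `` {i}"
      then obtain m where j: "j = u ^ m * i mod q" by (auto simp: power_rel_def)
      have "[u ^ m = u ^ (m mod ord q u)] (mod q)"
        using order_divides_expdiff[of q u] cu by (simp add: coprime_commute cong_def[of m] cong_sym_eq)
      then have "j = u ^ (m mod ord q u) * i mod q"
        unfolding j by (metis cong_def cong_scalar_right)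
      moreover have "m mod ord q u < ord q u"
        using cu by (simp add: coprime_commute)
      ultimately show "j \<in> (\<lambda>m. u ^ m * i mod q) ` {..<ord q u}" by blast
    qed
    show "(\<lambda>m. u ^ m * i mod q) ` {..<ord q u} \<subseteq> power_rel q u `` {i}"
      using mult_mod_prime_mem[OF q _ i] cu i by (auto simp: power_rel_def)
  qed
  moreover have "inj_on (\<lambda>m. u ^ m * i mod q) {..<ord q u}"
  proof (rule inj_onI)
    fix m n assume m: "m \<in> {..<ord q u}" "n \<in> {..<ord q u}" "u ^ m * i mod q = u ^ n * i mod q"
    then have "[u ^ m = u ^ n] (mod q)"
      using ci by (simp add: cong_def[symmetric] cong_mult_rcancel_nat)
    then have "[m = n] (mod ord q u)"
      using cu by (simp add: order_divides_expdiff coprime_commute)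
    then show "m = n" using m by (simp add: cong_def)
  qed
  ultimately show ?thesis by (simp add: card_image)
qed

lemma equiv_power_rel:
  assumes q: "prime q" and u: "u \<in> {1..<q}"
  shows "equiv {1..<q} (power_rel q u)"
proof (rule equivI)
  have cu: "coprime u q" using prime_coprime_less q u by auto
  show "power_rel q u \<subseteq> {1..<q} \<times> {1..<q}" by (auto simp: power_rel_def)
  show "refl_on {1..<q} (power_rel q u)"
    by (auto simp: refl_on_def power_rel_def intro!: exI[of _ 0])
  show "trans (power_rel q u)"
  proof (rule transI)
    fix i j k assume "(i, j) \<in> power_rel q u" "(j, k) \<in> power_rel q u"
    then obtain m n where *: "j = u ^ m * i mod q" "k = u ^ n * j mod q" "i \<in> {1..<q}" "k \<in> {1..<q}"
      by (auto simp: power_rel_def)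
    then have "k = u ^ (n + m) * i mod q"
      by (simp add: power_add mod_mult_right_eq mult.assoc)
    then show "(i, k) \<in> power_rel q u" using * by (auto simp: power_rel_def)
  qed
  show "sym (power_rel q u)"
  proof (rule symI)
    fix i j assume "(i, j) \<in> power_rel q u"
    then obtain m where *: "j = u ^ m * i mod q" "i \<in> {1..<q}" "j \<in> {1..<q}"
      by (auto simp: power_rel_def)
    \<comment> \<open>Chosen so that n + m is a multiple of the order, whence u^n inverts
      u^m.\<close>
    define n where "n = (ord q u - 1) * m"
    have "n + m = ord q u * m"
      using cu ord_gt_0_iff[of q u] by (cases "ord q u") (auto simp: n_def coprime_commute)
    then have "[u ^ n * u ^ m = 1] (mod q)"
      using ord_divides[of u "n + m" q] by (simp del: mult_cancel_left add: power_add[symmetric])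
    then have "[u ^ n * u ^ m * i = 1 * i] (mod q)" by (rule cong_scalar_right)
    then have "u ^ n * j mod q = i"
      using * by (simp add: cong_def mod_mult_right_eq mult.assoc)
    then show "(j, i) \<in> power_rel q u"
      using *(2,3) unfolding power_rel_def by blast
  qed
qed

text \<open>The q - 1 nonzero residues are partitioned into classes of equal size
  \<open>ord q u\<close>.\<close>

lemma card_power_quotient:
  assumes q: "prime q" and u: "u \<in> {1..<q}"
  shows "card ({1..<q} // power_rel q u) * ord q u = q - 1"
proof -
  note eq = equiv_power_rel[OF assms]
  have "ord q u * card ({1..<q} // power_rel q u) = card (\<Union>({1..<q} // power_rel q u))"
  proof (rule card_partition)
    show "finite ({1..<q} // power_rel q u)"
      using equiv_type[OF eq] by (simp add: finite_quotient)
    show "finite (\<Union>({1..<q} // power_rel q u))" using Union_quotient[OF eq] by simp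
    show "card c = ord q u" if "c \<in> {1..<q} // power_rel q u" for c
      using that card_power_class[OF assms] by (auto elim!: quotientE)
    show "c \<inter> d = {}" if "c \<in> {1..<q} // power_rel q u" "d \<in> {1..<q} // power_rel q u" "c \<noteq> d" for c d
      using quotient_disj[OF eq that(1,2)] that(3) by blast
  qed
  then show ?thesis using Union_quotient[OF eq] by (simp add: mult.commute)
qed

section \<open>The unit group acting on functions by scaling\<close>

text \<open>For prime q this is the unit group modulo q, on the same naturals that index the
  functions and in the form to which the library's Burnside lemma applies.\<close>

definition mult_mod_group :: "nat \<Rightarrow> nat monoid" where
  "mult_mod_group q = \<lparr>carrier = {1..<q}, monoid.mult = (\<lambda>a b. a * b mod q), one = 1\<rparr>"

lemma group_mult_mod_group:
  assumes q: "prime q"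
  shows "group (mult_mod_group q)"
proof (rule groupI)
  fix x assume "x \<in> carrier (mult_mod_group q)"
  then have x: "x \<in> {1..<q}" by (simp add: mult_mod_group_def)
  then obtain y where "[x * y = 1] (mod q)"
    using cong_solve_coprime_nat[OF prime_coprime_less[OF q x]] by auto
  then have y: "(y mod q) * x mod q = 1"
    using prime_gt_1_nat[OF q] by (simp add: cong_def mult.commute mod_mult_right_eq)
  then have "y mod q \<noteq> 0" by (intro notI) simp
  then have "y mod q \<in> {1..<q}" using prime_gt_0_nat[OF q] by simp
  then show "\<exists>y\<in>carrier (mult_mod_group q). y \<otimes>\<^bsub>mult_mod_group q\<^esub> x = \<one>\<^bsub>mult_mod_group q\<^esub>"
    using y by (auto simp: mult_mod_group_def)
qed (use q prime_gt_1_nat[OF q] mult_mod_prime_mem[OF q prime_coprime_less[OF q]] in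
    \<open>auto simp: mult_mod_group_def mod_mult_left_eq mod_mult_right_eq mult.assoc\<close>)

text \<open>Precomposition with multiplication by u. The inner restriction keeps the result
  extensional; the outer one makes the map itself extensional, as \<open>Bij\<close>
  requires.\<close>

definition scale_fun :: "nat \<Rightarrow> 'b set \<Rightarrow> nat \<Rightarrow> (nat \<Rightarrow> 'b) \<Rightarrow> nat \<Rightarrow> 'b" where
  "scale_fun q B u = (\<lambda>f \<in> {1..<q} \<rightarrow>\<^sub>E B. \<lambda>i\<in>{1..<q}. f (u * i mod q))"

lemma scale_fun_mem:
  assumes "prime q" "u \<in> {1..<q}" "f \<in> {1..<q} \<rightarrow>\<^sub>E B"
  shows "scale_fun q B u f \<in> {1..<q} \<rightarrow>\<^sub>E B"
proof (rule PiE_I)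
  fix i assume "i \<in> {1..<q}"
  then show "scale_fun q B u f i \<in> B"
    using assms(3) PiE_mem[OF assms(3) mult_mod_prime_mem[OF assms(1) prime_coprime_less[OF assms(1,2)]]]
    by (simp add: scale_fun_def)
qed (use assms(3) in \<open>auto simp: scale_fun_def\<close>)

text \<open>Precomposition reverses the factors; commutativity of multiplication still makes it a
  left action.\<close>

lemma scale_fun_mult:
  assumes "prime q" "u \<in> {1..<q}" "v \<in> {1..<q}" "f \<in> {1..<q} \<rightarrow>\<^sub>E B"
  shows "scale_fun q B (u * v mod q) f = scale_fun q B u (scale_fun q B v f)"
proof
  fix i
  show "scale_fun q B (u * v mod q) f i = scale_fun q B u (scale_fun q B v f) i"
    using scale_fun_mem[OF assms(1,3,4)] assms
      mult_mod_prime_mem[OF assms(1) prime_coprime_less[OF assms(1,2)], of i]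
    by (auto simp: scale_fun_def mod_mult_left_eq mod_mult_right_eq ac_simps)
qed

lemma group_action_scale_fun:
  assumes q: "prime q"
  shows "group_action (mult_mod_group q) ({1..<q} \<rightarrow>\<^sub>E B) (scale_fun q B)"
proof -
  let ?E = "{1..<q} \<rightarrow>\<^sub>E B"
  interpret U: group "mult_mod_group q" by (rule group_mult_mod_group[OF q])
  have car: "carrier (mult_mod_group q) = {1..<q}" by (simp add: mult_mod_group_def)
  have one: "scale_fun q B 1 f = f" if "f \<in> ?E" for f
    using that by (auto simp: scale_fun_def fun_eq_iff PiE_iff extensional_def)
  have bij: "scale_fun q B u \<in> Bij ?E" if u: "u \<in> {1..<q}" for u
  proof -
    \<comment> \<open>Scaling by the inverse unit is the inverse map.\<close>
    obtain v where v: "v \<in> {1..<q}" "v * u mod q = 1" "u * v mod q = 1"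
      using U.l_inv_ex[of u] u by (auto simp: mult_mod_group_def mult.commute)
    have "bij_betw (scale_fun q B u) ?E ?E"
    proof (rule bij_betw_byWitness[where f' = "scale_fun q B v"])
      show "\<forall>f\<in>?E. scale_fun q B v (scale_fun q B u f) = f"
        using scale_fun_mult[OF q v(1) u] one v by metis
      show "\<forall>f\<in>?E. scale_fun q B u (scale_fun q B v f) = f"
        using scale_fun_mult[OF q u v(1)] one v by metis
    qed (use scale_fun_mem[OF q] u v in blast)+
    then show ?thesis by (auto simp: Bij_def scale_fun_def)
  qed
  have "scale_fun q B \<in> hom (mult_mod_group q) (BijGroup ?E)"
  proof (rule homI)
    fix u v assume "u \<in> carrier (mult_mod_group q)" "v \<in> carrier (mult_mod_group q)"
    then have uv: "u \<in> {1..<q}" "v \<in> {1..<q}" by (auto simp: car)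
    have "scale_fun q B (u * v mod q) = compose ?E (scale_fun q B u) (scale_fun q B v)"
    proof
      fix f
      show "scale_fun q B (u * v mod q) f = compose ?E (scale_fun q B u) (scale_fun q B v) f"
      proof (cases "f \<in> ?E")
        case True
        with scale_fun_mult[OF q uv True] show ?thesis by (simp add: compose_def)
      qed (simp add: compose_def scale_fun_def)
    qed
    then show "scale_fun q B (u \<otimes>\<^bsub>mult_mod_group q\<^esub> v) =
        scale_fun q B u \<otimes>\<^bsub>BijGroup ?E\<^esub> scale_fun q B v"
      using bij uv by (simp add: BijGroup_def mult_mod_group_def)
  qed (use bij in \<open>simp add: car BijGroup_def\<close>)
  then show ?thesis
    by (simp add: group_action_def group_hom_def group_hom_axioms_def group_BijGroup U.group_axioms)
qed

text \<open>Being fixed by u means being constant on the cosets of the powers of u, and there are (q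
  - 1) / \<open>ord q u\<close> of these.\<close>

lemma card_invariants_scale_fun:
  assumes q: "prime q" and u: "u \<in> {1..<q}"
  shows "card (invariants ({1..<q} \<rightarrow>\<^sub>E B) (scale_fun q B) u) = card B ^ ((q - 1) div ord q u)"
proof -
  have cu: "coprime u q" using prime_coprime_less q u by auto
  have "invariants ({1..<q} \<rightarrow>\<^sub>E B) (scale_fun q B) u =
      {f \<in> {1..<q} \<rightarrow>\<^sub>E B. \<forall>(i, j) \<in> power_rel q u. f i = f j}" (is "?I = ?J")
  proof
    show "?J \<subseteq> ?I"
    proof clarify
      fix f assume f: "f \<in> {1..<q} \<rightarrow>\<^sub>E B" and inv: "\<forall>(i, j) \<in> power_rel q u. f i = f j"
      have "f (u * i mod q) = f i" if i: "i \<in> {1..<q}" for i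
      proof -
        have "(i, u ^ 1 * i mod q) \<in> power_rel q u"
          using mult_mod_prime_mem[OF q cu i] i unfolding power_rel_def by (auto intro!: exI[of _ 1])
        then show ?thesis using inv by auto
      qed
      then have "scale_fun q B u f = f"
        using f by (auto simp: scale_fun_def fun_eq_iff PiE_iff extensional_def)
      then show "f \<in> ?I" using f by (simp add: invariants_def)
    qed
    show "?I \<subseteq> ?J"
    proof
      fix f assume "f \<in> ?I"
      then have f: "f \<in> {1..<q} \<rightarrow>\<^sub>E B" and fixed: "scale_fun q B u f = f"
        by (auto simp: invariants_def)
      have step: "f (u * i mod q) = f i" if "i \<in> {1..<q}" for i
        using fun_cong[OF fixed, of i] f that by (simp add: scale_fun_def)
      have "f (u ^ m * i mod q) = f i" if i: "i \<in> {1..<q}" for m i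
      proof (induction m)
        case (Suc m)
        have "u ^ m * i mod q \<in> {1..<q}" using mult_mod_prime_mem[OF q _ i] cu by simp
        from step[OF this] Suc show ?case by (simp add: mod_mult_right_eq mult.assoc)
      qed (use i in simp)
      then show "f \<in> ?J" using f by (auto simp: power_rel_def)
    qed
  qed
  moreover have "card ({1..<q} // power_rel q u) = (q - 1) div ord q u"
    using card_power_quotient[OF q u] cu
    by (metis coprime_commute nonzero_mult_div_cancel_right not_gr_zero ord_gt_0_iff)
  ultimately show ?thesis
    using card_PiE_respecting[OF equiv_power_rel[OF q u], of B] by simp
qed

text \<open>For prime q this is the orbit relation of scaling, with an explicit unit because an
  isomorphism of transversals supplies one.\<close>

definition scale_rel :: "nat \<Rightarrow> 'b set \<Rightarrow> ((nat \<Rightarrow> 'b) \<times> (nat \<Rightarrow> 'b)) set" where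
  "scale_rel q B = {(f, f') \<in> ({1..<q} \<rightarrow>\<^sub>E B) \<times> ({1..<q} \<rightarrow>\<^sub>E B).
     \<exists>u\<in>{1..<q}. \<forall>i\<in>{1..<q}. f i = f' (u * i mod q)}"

text \<open>Burnside's lemma: the number of orbits times the group order is the sum of the numbers
  of fixed functions.\<close>

lemma card_scale_classes:
  assumes q: "prime q" and B: "finite B"
  shows "card (({1..<q} \<rightarrow>\<^sub>E B) // scale_rel q B) * (q - 1) =
    (\<Sum>u\<in>{1..<q}. card B ^ ((q - 1) div ord q u))"
proof -
  let ?E = "{1..<q} \<rightarrow>\<^sub>E B"
  interpret A: group_action "mult_mod_group q" ?E "scale_fun q B"
    by (rule group_action_scale_fun[OF q])
  have car: "carrier (mult_mod_group q) = {1..<q}" by (simp add: mult_mod_group_def)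
  have "scale_rel q B `` {f} = orbit (mult_mod_group q) (scale_fun q B) f" if f: "f \<in> ?E" for f
  proof -
    \<comment> \<open>The relation puts \<open>f\<close> into the orbit of \<open>f'\<close>; the
      symmetry of orbits then gives the converse membership.\<close>
    have iff: "(f, f') \<in> scale_rel q B \<longleftrightarrow> f \<in> orbit (mult_mod_group q) (scale_fun q B) f'"
      if f': "f' \<in> ?E" for f'
    proof -
      have "(\<forall>i\<in>{1..<q}. f i = f' (u * i mod q)) \<longleftrightarrow> f = scale_fun q B u f'" for u
        using f f' by (auto simp: scale_fun_def fun_eq_iff PiE_iff extensional_def)
      then show ?thesis using f f' by (auto simp: scale_rel_def orbit_def car)
    qed
    show ?thesis
    proof (intro Set.set_eqI iffI)
      fix f' assume "f' \<in> scale_rel q B `` {f}"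
      moreover from this have "f' \<in> ?E" by (auto simp: scale_rel_def)
      ultimately show "f' \<in> orbit (mult_mod_group q) (scale_fun q B) f"
        using iff f A.orbit_sym by blast
    next
      fix f' assume "f' \<in> orbit (mult_mod_group q) (scale_fun q B) f"
      moreover from this have "f' \<in> ?E" using A.element_image f by (auto simp: orbit_def)
      ultimately show "f' \<in> scale_rel q B `` {f}"
        using iff f A.orbit_sym by blast
    qed
  qed
  then have "?E // scale_rel q B = orbits (mult_mod_group q) ?E (scale_fun q B)"
    by (auto simp: quotient_def orbits_def)
  moreover have "order (mult_mod_group q) = q - 1" by (simp add: order_def car)
  ultimately show ?thesis
    using A.burnside B card_invariants_scale_fun[OF q, where B = B]
    by (simp add: car finite_PiE)
qed

subsection \<open>Transversals in a semidirect product\<close>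

text \<open>The group in coordinates: each element is uniquely g^i h, and \<chi>(h) is the exponent
  by which h acts on g under conjugation. Noncommutativity enters as the injectivity of \<chi>, and
  p < q as the bound on \<open>card H\<close>.\<close>

locale cyclic_semidirect = group G for G (structure) +
  fixes H :: "'a set" and q :: nat and g :: 'a and \<chi> :: "'a \<Rightarrow> nat"
  assumes q: "prime q"
    and sub: "subgroup H G"
    and card_H: "card H < q"
    and fin_H: "finite H"
    and g: "g \<in> carrier G"
    and ord_g: "group.ord G g = q"
    and decomp: "bij_betw (\<lambda>(i, h). g [^] i \<otimes> h) ({..<q} \<times> H) (carrier G)"
    and act: "h \<in> H \<Longrightarrow> h \<otimes> g = g [^] \<chi> h \<otimes> h"
    and act_less: "h \<in> H \<Longrightarrow> \<chi> h < q"
    and act_inj: "inj_on \<chi> H"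
begin

lemma q0: "0 < q" using prime_gt_0_nat[OF q] .

lemma H_carrier [simp]: "h \<in> H \<Longrightarrow> h \<in> carrier G"
  using subgroup.mem_carrier[OF sub] .

lemma H_one [simp]: "\<one> \<in> H" using subgroup.one_closed[OF sub] .

lemma g_pow_closed [simp]: "g [^] (i::nat) \<in> carrier G" using g by simp

lemma g_pow_eq_iff: "g [^] (i::nat) = g [^] (j::nat) \<longleftrightarrow> [i = j] (mod q)"
proof -
  have "g [^] i = g [^] j \<longleftrightarrow> g [^] int i = g [^] int j" by (simp add: int_pow_int)
  also have "\<dots> \<longleftrightarrow> int q dvd int j - int i" using int_pow_eq[OF g] ord_g by simp
  also have "\<dots> \<longleftrightarrow> [j = i] (mod q)" by (simp add: cong_iff_dvd_diff flip: cong_int_iff)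
  finally show ?thesis by (simp add: cong_sym_eq)
qed

lemma g_pow_mod: "g [^] (i mod q) = g [^] (i::nat)"
  by (simp add: g_pow_eq_iff cong_def)

lemma act_pow: "h \<in> H \<Longrightarrow> h \<otimes> g [^] (j::nat) = g [^] (\<chi> h * j) \<otimes> h"
proof (induction j)
  case (Suc j)
  have "h \<otimes> g [^] Suc j = (h \<otimes> g [^] j) \<otimes> g" using Suc.prems g by (simp add: m_assoc)
  also have "\<dots> = g [^] (\<chi> h * j) \<otimes> (h \<otimes> g)" using Suc g by (simp add: m_assoc)
  also have "\<dots> = g [^] (\<chi> h * j) \<otimes> g [^] \<chi> h \<otimes> h" using Suc.prems g by (simp add: act m_assoc)
  also have "\<dots> = g [^] (\<chi> h * Suc j) \<otimes> h" using g by (simp add: nat_pow_mult add.commute)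
  finally show ?case .
qed simp

lemma act_one: "\<chi> \<one> = 1"
proof -
  have "g [^] (1::nat) = g [^] \<chi> \<one>" using act[of \<one>] g by simp
  then have "[1 = \<chi> \<one>] (mod q)" by (simp only: g_pow_eq_iff)
  then show ?thesis using act_less[of \<one>] prime_gt_1_nat[OF q] by (simp add: cong_def)
qed

lemma act_coprime: "h \<in> H \<Longrightarrow> coprime (\<chi> h) q"
proof -
  assume h: "h \<in> H"
  \<comment> \<open>Exponent 0 would give h g = h and so make g trivial, against its order
    q.\<close>
  have "\<chi> h \<noteq> 0"
  proof
    assume "\<chi> h = 0"
    then have "h \<otimes> g = h" using act[OF h] h by simp
    then have "g = \<one>" using h g by simp
    then show False using ord_g prime_gt_1_nat[OF q] group.ord_eq_1[OF group_axioms g] by simp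
  qed
  then show ?thesis using prime_coprime_less[OF q, of "\<chi> h"] act_less[OF h] by simp
qed

lemma decompD:
  assumes "g [^] i \<otimes> h = g [^] j \<otimes> h'" "i < q" "j < q" "h \<in> H" "h' \<in> H"
  shows "i = j" "h = h'"
proof -
  have "inj_on (\<lambda>(i, h). g [^] i \<otimes> h) ({..<q} \<times> H)" using decomp by (simp add: bij_betw_def)
  from inj_onD[OF this, of "(i, h)" "(j, h')"] assms show "i = j" "h = h'" by auto
qed

lemma decompE:
  assumes "x \<in> carrier G"
  obtains i h where "i < q" "h \<in> H" "x = g [^] i \<otimes> h"
proof -
  have "x \<in> (\<lambda>(i, h). g [^] i \<otimes> h) ` ({..<q} \<times> H)" using assms decomp by (simp add: bij_betw_def)
  then show ?thesis using that by auto
qed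

lemma mem_coset_iff:
  assumes "i < q" "j < q" "h \<in> H"
  shows "g [^] i \<otimes> h \<in> g [^] j <#\<^bsub>G\<^esub> H \<longleftrightarrow> i = j"
proof
  assume "g [^] i \<otimes> h \<in> g [^] j <#\<^bsub>G\<^esub> H"
  then obtain h' where "h' \<in> H" "g [^] i \<otimes> h = g [^] j \<otimes> h'" by (auto simp: l_coset_def)
  with assms show "i = j"
    using decompD(1) by blast
qed (use assms in \<open>auto simp: l_coset_def\<close>)

lemma coset_rep:
  assumes "h \<in> H"
  shows "(g [^] (k::nat) \<otimes> h) <#\<^bsub>G\<^esub> H = g [^] (k mod q) <#\<^bsub>G\<^esub> H"
proof -
  have "g [^] k \<otimes> h \<in> g [^] k <#\<^bsub>G\<^esub> H" using assms by (auto simp: l_coset_def)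
  from l_repr_independence[OF this _ sub] show ?thesis by (simp add: g_pow_mod)
qed

section \<open>Transversals in coordinates\<close>

text \<open>Residue 0 stands for the coset H, whose representative must be the identity; only the
  nonzero residues carry a free choice in H.\<close>

definition coord :: "(nat \<Rightarrow> 'a) \<Rightarrow> nat \<Rightarrow> 'a" where
  "coord f = f(0 := \<one>)"

definition sec :: "(nat \<Rightarrow> 'a) \<Rightarrow> nat \<Rightarrow> 'a" where
  "sec f i = g [^] i \<otimes> coord f i"

definition trans_of :: "(nat \<Rightarrow> 'a) \<Rightarrow> 'a set" where
  "trans_of f = sec f ` {..<q}"

lemma coord_mem: "f \<in> {1..<q} \<rightarrow>\<^sub>E H \<Longrightarrow> i < q \<Longrightarrow> coord f i \<in> H"
  by (auto simp: coord_def PiE_iff)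

lemma sec_closed: "f \<in> {1..<q} \<rightarrow>\<^sub>E H \<Longrightarrow> i < q \<Longrightarrow> sec f i \<in> carrier G"
  using coord_mem by (simp add: sec_def)

lemma sec_eqD:
  assumes "f \<in> {1..<q} \<rightarrow>\<^sub>E H" "f' \<in> {1..<q} \<rightarrow>\<^sub>E H" "i < q" "j < q" "sec f i = sec f' j"
  shows "i = j" "coord f i = coord f' j"
  using decompD[OF assms(5)[unfolded sec_def] assms(3,4) coord_mem[OF assms(1,3)]
      coord_mem[OF assms(2,4)]] by auto

lemma bij_betw_sec: "f \<in> {1..<q} \<rightarrow>\<^sub>E H \<Longrightarrow> bij_betw (sec f) {..<q} (trans_of f)"
  using sec_eqD(1) by (auto simp: bij_betw_def trans_of_def inj_on_def)

text \<open>The coset of g^k h depends only on k modulo q. This gives both the transversal property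
  and the induced operation.\<close>

lemma trans_of_Int_coset:
  assumes f: "f \<in> {1..<q} \<rightarrow>\<^sub>E H" and h: "h \<in> H"
  shows "trans_of f \<inter> ((g [^] (k::nat) \<otimes> h) <#\<^bsub>G\<^esub> H) = {sec f (k mod q)}"
proof -
  have "sec f i \<in> g [^] (k mod q) <#\<^bsub>G\<^esub> H \<longleftrightarrow> i = k mod q" if "i < q" for i
    using mem_coset_iff[OF that _ coord_mem[OF f that], of "k mod q"] q0 by (simp add: sec_def)
  moreover have "k mod q < q" using q0 by simp
  ultimately show ?thesis unfolding coset_rep[OF h] trans_of_def by auto
qed

lemma left_transversal_trans_of:
  assumes f: "f \<in> {1..<q} \<rightarrow>\<^sub>E H"
  shows "left_transversal G H (trans_of f)"
  unfolding left_transversal_def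
proof (intro conjI ballI)
  show "trans_of f \<subseteq> carrier G" using sec_closed[OF f] by (auto simp: trans_of_def)
  have "sec f 0 = \<one>" by (simp add: sec_def coord_def)
  then show "\<one> \<in> trans_of f" using q0 unfolding trans_of_def by (metis imageI lessThan_iff)
  fix C assume "C \<in> lcosets H"
  then obtain x where x: "x \<in> carrier G" "C = x <#\<^bsub>G\<^esub> H" by (auto simp: LCOSETS_def)
  obtain k :: nat and h where "h \<in> H" "x = g [^] k \<otimes> h"
    by (rule decompE[OF x(1)])
  then show "\<exists>!s. s \<in> trans_of f \<inter> C"
    using trans_of_Int_coset[OF f] x(2) by auto
qed

text \<open>Moving x = \<open>coord f i\<close> past g^j multiplies the exponent j by \<chi>(x); the
  remaining factor lies in H and is absorbed by the coset.\<close>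

lemma transversal_op_trans_of:
  assumes f: "f \<in> {1..<q} \<rightarrow>\<^sub>E H" and i: "i < q" and j: "j < q"
  shows "transversal_op G H (trans_of f) (sec f i) (sec f j) =
    sec f ((i + \<chi> (coord f i) * j) mod q)"
proof -
  let ?x = "coord f i" and ?y = "coord f j"
  have xy: "?x \<in> H" "?y \<in> H" using coord_mem[OF f] i j by auto
  have "sec f i \<otimes> sec f j = g [^] i \<otimes> (?x \<otimes> g [^] j) \<otimes> ?y"
    using xy by (simp add: sec_def m_assoc)
  also have "\<dots> = g [^] i \<otimes> g [^] (\<chi> ?x * j) \<otimes> (?x \<otimes> ?y)"
    using xy by (simp add: act_pow m_assoc)
  also have "\<dots> = g [^] (i + \<chi> ?x * j) \<otimes> (?x \<otimes> ?y)"
    using g by (simp add: nat_pow_mult)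
  finally have "trans_of f \<inter> ((sec f i \<otimes> sec f j) <#\<^bsub>G\<^esub> H) = {sec f ((i + \<chi> ?x * j) mod q)}"
    using trans_of_Int_coset[OF f subgroup.m_closed[OF sub xy]] by simp
  then show ?thesis by (simp add: transversal_op_def)
qed

text \<open>The function is read off from the H-parts of the elements of S, one in each coset g^i
  H.\<close>

lemma left_transversal_imp_trans_of:
  assumes S: "left_transversal G H S"
  obtains f where "f \<in> {1..<q} \<rightarrow>\<^sub>E H" "trans_of f = S"
proof -
  have ex: "\<exists>!s. s \<in> S \<inter> (g [^] i <#\<^bsub>G\<^esub> H)" for i :: nat
    using S by (auto simp: left_transversal_def LCOSETS_def)
  define f where "f = (\<lambda>i\<in>{1..<q}. SOME h. h \<in> H \<and> g [^] i \<otimes> h \<in> S)"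
  have "\<exists>h. h \<in> H \<and> g [^] i \<otimes> h \<in> S" for i :: nat
    using ex[of i] by (auto simp: l_coset_def)
  from someI_ex[OF this] have f_mem: "f i \<in> H" "g [^] i \<otimes> f i \<in> S" if "i \<in> {1..<q}" for i
    using that by (auto simp: f_def)
  then have f: "f \<in> {1..<q} \<rightarrow>\<^sub>E H" by (auto simp: f_def)
  \<comment> \<open>At i = 0 this is the requirement that a transversal contain the
    identity.\<close>
  have sec_S: "sec f i \<in> S" if "i < q" for i
    using that f_mem(2)[of i] S by (cases "i = 0") (auto simp: sec_def coord_def left_transversal_def)
  have "S \<subseteq> trans_of f"
  proof
    fix s assume s: "s \<in> S"
    then have "s \<in> carrier G" using S by (auto simp: left_transversal_def)
    then obtain i h where i: "i < q" "h \<in> H" "s = g [^] i \<otimes> h"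
      by (auto elim: decompE)
    then have "s \<in> S \<inter> (g [^] i <#\<^bsub>G\<^esub> H)" using s by (auto simp: l_coset_def)
    moreover have "sec f i \<in> S \<inter> (g [^] i <#\<^bsub>G\<^esub> H)"
      using sec_S[OF i(1)] coord_mem[OF f i(1)] by (auto simp: sec_def l_coset_def)
    ultimately have "s = sec f i" using ex by blast
    then show "s \<in> trans_of f" using i by (auto simp: trans_of_def)
  qed
  then have "trans_of f = S" using sec_S by (auto simp: trans_of_def)
  with f show ?thesis by (rule that)
qed

lemma bij_betw_trans_of:
  "bij_betw trans_of ({1..<q} \<rightarrow>\<^sub>E H) {S. left_transversal G H S}"
proof (rule bij_betw_imageI)
  show "inj_on trans_of ({1..<q} \<rightarrow>\<^sub>E H)"
  proof (rule inj_onI)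
    fix f f' assume f: "f \<in> {1..<q} \<rightarrow>\<^sub>E H" "f' \<in> {1..<q} \<rightarrow>\<^sub>E H" "trans_of f = trans_of f'"
    show "f = f'"
    proof (rule PiE_ext[OF f(1,2)])
      fix i assume i: "i \<in> {1..<q}"
      then have "sec f i \<in> trans_of f'" unfolding f(3)[symmetric] by (auto simp: trans_of_def)
      then obtain j where j: "j < q" "sec f i = sec f' j" by (auto simp: trans_of_def)
      then have "coord f i = coord f' i" using sec_eqD[OF f(1,2) _ j] i by auto
      then show "f i = f' i" using i by (simp add: coord_def)
    qed
  qed
  show "trans_of ` ({1..<q} \<rightarrow>\<^sub>E H) = {S. left_transversal G H S}"
    using left_transversal_trans_of left_transversal_imp_trans_of by blast
qed

section \<open>Isomorphisms of transversals\<close>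

text \<open>On residues an isomorphism intertwines two twisted additions, so it is multiplication by
  a unit that preserves slopes. Conversely, multiplication by u respects the operations once the
  coordinates at k and u k agree.\<close>

lemma transversal_iso_trans_of_iff:
  assumes f: "f \<in> {1..<q} \<rightarrow>\<^sub>E H" and f': "f' \<in> {1..<q} \<rightarrow>\<^sub>E H"
  shows "transversal_iso G H (trans_of f) (trans_of f') \<longleftrightarrow> (f, f') \<in> scale_rel q H"
proof
  assume "transversal_iso G H (trans_of f) (trans_of f')"
  then obtain F where F: "bij_betw F (trans_of f) (trans_of f')"
    and F_op: "\<And>x y. x \<in> trans_of f \<Longrightarrow> y \<in> trans_of f \<Longrightarrow>
      F (transversal_op G H (trans_of f) x y) = transversal_op G H (trans_of f') (F x) (F y)"
    by (auto simp: transversal_iso_def)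
  define \<phi> where "\<phi> = inv_into {..<q} (sec f') \<circ> F \<circ> sec f"
  have bij: "bij_betw \<phi> {..<q} {..<q}"
    unfolding \<phi>_def
    using bij_betw_sec[OF f] F bij_betw_inv_into[OF bij_betw_sec[OF f']] by (intro bij_betw_trans)
  then have \<phi>_less: "\<phi> i < q" if "i < q" for i using that by (auto simp: bij_betw_def)
  have sec_mem: "sec f i \<in> trans_of f" if "i < q" for i using that by (simp add: trans_of_def)
  have sec_\<phi>: "sec f' (\<phi> i) = F (sec f i)" if "i < q" for i
  proof -
    have "F (sec f i) \<in> trans_of f'" using F sec_mem[OF that] by (auto simp: bij_betw_def)
    then show ?thesis by (simp add: \<phi>_def trans_of_def f_inv_into_f)
  qed
  have hom: "\<phi> ((i + \<chi> (coord f i) * j) mod q) = (\<phi> i + \<chi> (coord f' (\<phi> i)) * \<phi> j) mod q"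
    if i: "i < q" and j: "j < q" for i j
  proof -
    have "sec f' (\<phi> ((i + \<chi> (coord f i) * j) mod q)) =
        F (transversal_op G H (trans_of f) (sec f i) (sec f j))"
      using sec_\<phi> transversal_op_trans_of[OF f i j] q0 by simp
    also have "\<dots> = transversal_op G H (trans_of f') (sec f' (\<phi> i)) (sec f' (\<phi> j))"
      using F_op[OF sec_mem sec_mem] sec_\<phi> i j by simp
    also have "\<dots> = sec f' ((\<phi> i + \<chi> (coord f' (\<phi> i)) * \<phi> j) mod q)"
      using transversal_op_trans_of[OF f'] \<phi>_less i j by simp
    finally show ?thesis using sec_eqD(1)[OF f' f'] \<phi>_less q0 by simp
  qed
  \<comment> \<open>Pigeonhole: there are q residues but fewer elements of H, so two residues share
    a coordinate and hence a slope.\<close>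
  have "card (coord f ` {..<q}) < card {..<q}"
  proof -
    have "card (coord f ` {..<q}) \<le> card H"
      using coord_mem[OF f] fin_H by (intro card_mono) auto
    then show ?thesis using card_H by simp
  qed
  then have "\<not> inj_on (coord f) {..<q}" by (rule pigeonhole)
  then obtain i j where ij: "i < q" "j < q" "i \<noteq> j" "coord f i = coord f j"
    by (auto simp: inj_on_def)
  obtain u where u: "u \<in> {1..<q}" "\<And>k. k < q \<Longrightarrow> \<phi> k = u * k mod q"
      "\<And>k. k < q \<Longrightarrow> [\<chi> (coord f k) = \<chi> (coord f' (\<phi> k))] (mod q)"
  proof (rule affine_twisted_hom_linear[OF q bij _ _ hom ij(1-3)])
    show "coprime (\<chi> (coord f i)) q" "coprime (\<chi> (coord f' i)) q" if "i < q" for i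
      using act_coprime[OF coord_mem[OF f that]] act_coprime[OF coord_mem[OF f' that]] .
  qed (use ij in auto)
  have "f k = f' (u * k mod q)" if k: "k \<in> {1..<q}" for k
  proof -
    have uk: "u * k mod q \<in> {1..<q}"
      by (rule mult_mod_prime_mem[OF q prime_coprime_less[OF q u(1)] k])
    have mem: "coord f k \<in> H" "coord f' (u * k mod q) \<in> H"
      using coord_mem[OF f] coord_mem[OF f'] k uk by auto
    \<comment> \<open>Values of \<chi> lie below q, so congruent slopes are equal, and injectivity
      of \<chi> recovers the elements of H.\<close>
    have "[\<chi> (coord f k) = \<chi> (coord f' (u * k mod q))] (mod q)" using u(2,3)[of k] k by simp
    then have "\<chi> (coord f k) = \<chi> (coord f' (u * k mod q))"
      using act_less mem by (simp add: cong_def)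
    then have "coord f k = coord f' (u * k mod q)" using inj_onD[OF act_inj] mem by blast
    then show ?thesis using k uk by (simp add: coord_def)
  qed
  then show "(f, f') \<in> scale_rel q H" using f f' u(1) by (auto simp: scale_rel_def)
next
  assume "(f, f') \<in> scale_rel q H"
  then obtain u where u: "u \<in> {1..<q}" and uf: "\<And>k. k \<in> {1..<q} \<Longrightarrow> f k = f' (u * k mod q)"
    by (auto simp: scale_rel_def)
  let ?m = "\<lambda>k. u * k mod q"
  have cu: "coprime u q" by (rule prime_coprime_less[OF q u])
  \<comment> \<open>The hypothesis covers nonzero k; 0 is mapped to 0, where both coordinates are
    the identity.\<close>
  have coord_eq: "coord f' (?m k) = coord f k" if "k < q" for k
    using uf[of k] mult_mod_prime_mem[OF q cu, of k] that by (cases "k = 0") (auto simp: coord_def)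
  have inj: "inj_on ?m {..<q}"
    using cu by (auto simp: inj_on_def cong_def[symmetric] cong_mult_lcancel_nat) (simp add: cong_def)
  have bij: "bij_betw ?m {..<q} {..<q}"
    using inj endo_inj_surj[OF finite_lessThan _ inj] q0 by (simp add: bij_betw_def image_subset_iff)
  define F where "F = sec f' \<circ> ?m \<circ> inv_into {..<q} (sec f)"
  have "bij_betw F (trans_of f) (trans_of f')"
    unfolding F_def
    using bij_betw_inv_into[OF bij_betw_sec[OF f]] bij bij_betw_sec[OF f'] 
    by (intro bij_betw_trans)
  moreover have F_sec: "F (sec f k) = sec f' (?m k)" if "k < q" for k
    using that bij_betw_inv_into_left[OF bij_betw_sec[OF f]] by (simp add: F_def)
  have "F (transversal_op G H (trans_of f) x y) = transversal_op G H (trans_of f') (F x) (F y)"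
    if xy: "x \<in> trans_of f" "y \<in> trans_of f" for x y
  proof -
    obtain i j where ij: "i < q" "j < q" "x = sec f i" "y = sec f j"
      using xy by (auto simp: trans_of_def)
    have "F (transversal_op G H (trans_of f) x y) = sec f' (?m ((i + \<chi> (coord f i) * j) mod q))"
      using ij transversal_op_trans_of[OF f] F_sec q0 by simp
    also have "?m ((i + \<chi> (coord f i) * j) mod q) = (u * i + \<chi> (coord f i) * (u * j)) mod q"
      by (simp add: mod_mult_right_eq algebra_simps)
    also have "\<dots> = (?m i + \<chi> (coord f' (?m i)) * ?m j) mod q"
      unfolding coord_eq[OF ij(1)] by (intro mod_add_cong mod_mult_cong) simp_all
    also have "sec f' \<dots> = transversal_op G H (trans_of f') (F x) (F y)"
      using ij transversal_op_trans_of[OF f'] F_sec q0 by simp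
    finally show ?thesis .
  qed
  ultimately show "transversal_iso G H (trans_of f) (trans_of f')"
    unfolding transversal_iso_def by blast
qed

lemma ict_eq_card_scale_classes: "ict G H = card (({1..<q} \<rightarrow>\<^sub>E H) // scale_rel q H)"
  unfolding ict_def
  by (rule card_quotient_bij_betw[OF bij_betw_trans_of, symmetric])
    (use transversal_iso_trans_of_iff left_transversal_trans_of in \<open>auto simp: scale_rel_def\<close>)

end

subsection \<open>Groups of order \<open>pq\<close>\<close>

text \<open>If a b = a' b', then a'^-1 a = b' b^-1 lies in both subgroups.\<close>

lemma (in group) inj_on_mult_trivial_Int:
  assumes A: "subgroup A G" and B: "subgroup B G" and "A \<inter> B = {\<one>}"
  shows "inj_on (\<lambda>(a, b). a \<otimes> b) (A \<times> B)"
proof -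
  have "a = a' \<and> b = b'"
    if ab: "a \<in> A" "a' \<in> A" "b \<in> B" "b' \<in> B" and eq: "a \<otimes> b = a' \<otimes> b'" for a a' b b'
  proof -
    have car: "a \<in> carrier G" "a' \<in> carrier G" "b \<in> carrier G" "b' \<in> carrier G"
      using ab subgroup.mem_carrier[OF A] subgroup.mem_carrier[OF B] by auto
    have "inv a' \<otimes> a \<in> A" "b' \<otimes> inv b \<in> B"
      using ab A B by (auto intro: subgroup.m_closed subgroup.m_inv_closed)
    moreover have "inv a' \<otimes> a = b' \<otimes> inv b"
    proof -
      have "inv a' \<otimes> a = inv a' \<otimes> (a \<otimes> b) \<otimes> inv b" using car by (simp add: m_assoc)
      also have "\<dots> = b' \<otimes> inv b" unfolding eq using car by (simp add: m_assoc[symmetric])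
      finally show ?thesis .
    qed
    ultimately have "inv a' \<otimes> a = \<one>" using assms(3) by auto
    then have "a = a'" using car by (metis inv_inv inv_equality inv_closed)
    then show ?thesis using eq car by simp
  qed
  then show ?thesis by (auto simp: inj_on_def)
qed

text \<open>By Lagrange the order of the intersection divides the prime
  \<open>card A\<close>.\<close>

lemma (in group) prime_subgroup_Int:
  assumes A: "subgroup A G" and B: "subgroup B G" and "prime (card A)"
  shows "A \<inter> B = {\<one>} \<or> A \<subseteq> B"
proof -
  have fin: "finite A" using assms(3) by (metis card.infinite not_prime_0)
  interpret A: group "G\<lparr>carrier := A\<rparr>" using subgroup.subgroup_is_group[OF A group_axioms] .
  have "subgroup (A \<inter> B) (G\<lparr>carrier := A\<rparr>)"
    by (rule subgroup_incl[OF subgroups_Inter_pair[OF A B] A]) simp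
  from A.lagrange[OF this] have "card (A \<inter> B) dvd card A"
    by (metis dvd_triv_right order_def partial_object.select_convs(1) partial_object.surjective
        partial_object.update_convs(1))
  then consider "card (A \<inter> B) = 1" | "card (A \<inter> B) = card A"
    using assms(3) by (auto simp: prime_nat_iff)
  then show ?thesis
  proof cases
    case 1
    moreover have "\<one> \<in> A \<inter> B" using subgroup.one_closed A B by auto
    ultimately show ?thesis by (metis card_1_singletonE singletonD)
  next
    case 2
    then have "A \<inter> B = A" using fin by (intro card_subset_eq) auto
    then show ?thesis by blast
  qed
qed

lemma (in group) prime_subgroup_eq_powers:
  assumes A: "subgroup A G" and "prime (card A)" and fin: "finite (carrier G)"
    and x: "x \<in> A" "x \<noteq> \<one>"
  shows "group.ord G x = card A" "A = {x [^] k | k. k < card A}"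
proof -
  have xc: "x \<in> carrier G" using x(1) subgroup.mem_carrier[OF A] by simp
  have gen: "subgroup (generate G {x}) G" using xc by (intro generate_is_subgroup) simp
  have "x \<in> A \<inter> generate G {x}" using x(1) by (simp add: generate.incl)
  then have "A \<subseteq> generate G {x}" using prime_subgroup_Int[OF A gen assms(2)] x(2) by auto
  moreover have "generate G {x} \<subseteq> A" using generate_subgroup_incl[OF _ A] x(1) by simp
  ultimately have eq: "A = generate G {x}" by simp
  then show o: "group.ord G x = card A" using generate_pow_card[OF xc] by simp
  have "A = {x [^] k | k. k \<in> {0..group.ord G x - 1}}"
    using eq generate_pow_on_finite_carrier[OF fin xc] ord_elems[OF fin xc] by simp
  moreover have "k \<in> {0..card A - 1} \<longleftrightarrow> k < card A" for k
    using prime_gt_0_nat[OF assms(2)] by auto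
  ultimately show "A = {x [^] k | k. k < card A}" by (simp only: o)
qed

text \<open>Normality by counting: a conjugate meeting Q trivially would give card(Q)^2 distinct
  products, more than G has elements. So Q lies in its conjugate, which has the same size.\<close>

lemma (in group) large_prime_subgroup_conjugate:
  assumes fin: "finite (carrier G)" and Q: "subgroup Q G" and "prime (card Q)"
    and large: "order G < card Q * card Q" and x: "x \<in> carrier G" and y: "y \<in> Q"
  shows "x \<otimes> y \<otimes> inv x \<in> Q"
proof -
  let ?Q' = "(x <#\<^bsub>G\<^esub> Q) #>\<^bsub>G\<^esub> inv x"
  have Q': "subgroup ?Q' G" by (rule subgroup_conjugation_is_surj2[OF x Q])
  have img: "?Q' = (\<lambda>y. x \<otimes> y \<otimes> inv x) ` Q" by (auto simp: l_coset_def r_coset_def)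
  have "inj_on (\<lambda>y. x \<otimes> y \<otimes> inv x) Q"
    using conjugation_is_inj[OF x] subgroup.mem_carrier[OF Q] by (auto simp: inj_on_def)
  then have card: "card ?Q' = card Q" unfolding img by (rule card_image)
  have "Q \<inter> ?Q' \<noteq> {\<one>}"
  proof
    assume "Q \<inter> ?Q' = {\<one>}"
    from inj_on_mult_trivial_Int[OF Q Q' this]
    have "card ((\<lambda>(a, b). a \<otimes> b) ` (Q \<times> ?Q')) = card Q * card Q"
      by (simp add: card_image card_cartesian_product card)
    moreover have "(\<lambda>(a, b). a \<otimes> b) ` (Q \<times> ?Q') \<subseteq> carrier G"
      using subgroup.mem_carrier[OF Q] subgroup.mem_carrier[OF Q'] by auto
    ultimately show False
      using card_mono[OF fin] large unfolding order_def by (metis linorder_not_le)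
  qed
  then have "Q \<subseteq> ?Q'" using prime_subgroup_Int[OF Q Q' assms(3)] by blast
  moreover have "finite ?Q'" using finite_subset[OF subgroup.subset[OF Q'] fin] .
  ultimately have "Q = ?Q'" using card by (intro card_subset_eq) auto
  then show ?thesis using y img by blast
qed

text \<open>A Sylow q-subgroup Q meets H trivially, so the products fill G by counting, and Q is
  normal because pq < q^2. If \<chi> were not injective, H would commute with Q and G would be
  abelian.\<close>

lemma (in group) cyclic_semidirect_pq:
  assumes p: "prime p" and q: "prime q" and pq: "p < q"
    and nonab: "\<not> comm_group G" and ord_G: "order G = p * q"
    and H: "subgroup H G" and card_H: "card H = p"
  obtains g \<chi> where "cyclic_semidirect G H q g \<chi>"
proof -
  have q0: "0 < q" using prime_gt_0_nat[OF q] .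
  have p0: "0 < p" using prime_gt_0_nat[OF p] .
  have fin: "finite (carrier G)"
    using ord_G p0 q0 by (metis order_gt_0_iff_finite nat_0_less_mult_iff)
  obtain Q where Q: "subgroup Q G" "card Q = q"
    using sylow_thm[of q G 1 p] q ord_G fin group_axioms by (auto simp: mult.commute)
  have "\<one> \<in> Q" using subgroup.one_closed[OF Q(1)] .
  have "Q \<noteq> {\<one>}" using Q(2) prime_gt_1_nat[OF q] by auto
  then obtain g where g: "g \<in> Q" "g \<noteq> \<one>" using \<open>\<one> \<in> Q\<close> by blast
  have gc: "g \<in> carrier G" using subgroup.mem_carrier[OF Q(1) g(1)] .
  have prQ: "prime (card Q)" using Q(2) q by simp
  note Qpow = prime_subgroup_eq_powers[OF Q(1) prQ fin g, unfolded Q(2)]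
  have Hc: "h \<in> carrier G" if "h \<in> H" for h using subgroup.mem_carrier[OF H that] .
  have finH: "finite H" using finite_subset[OF subgroup.subset[OF H] fin] .
  \<comment> \<open>Excluded by size; as Q has prime order, its intersection with H is then
    trivial.\<close>
  have "\<not> Q \<subseteq> H" using card_mono[OF finH, of Q] Q(2) card_H pq by auto
  then have QH: "Q \<inter> H = {\<one>}" using prime_subgroup_Int[OF Q(1) H prQ] by blast
  have g_inj: "i = j" if "i < q" "j < q" "g [^] i = g [^] j" for i j :: nat
    using inj_onD[OF ord_inj[OF gc] that(3)] that(1,2) Qpow(1) by auto
  have decomp: "bij_betw (\<lambda>(i, h). g [^] i \<otimes> h) ({..<q} \<times> H) (carrier G)"
  proof (rule bij_betw_imageI)
    show inj: "inj_on (\<lambda>(i, h). g [^] (i::nat) \<otimes> h) ({..<q} \<times> H)"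
    proof (rule inj_onI, clarsimp)
      fix i j h h'
      assume *: "i < q" "j < q" "h \<in> H" "h' \<in> H" "g [^] i \<otimes> h = g [^] j \<otimes> h'"
      have "g [^] i \<in> Q" "g [^] j \<in> Q" using Qpow(2) *(1,2) by blast+
      then have "g [^] i = g [^] j \<and> h = h'"
        using inj_onD[OF inj_on_mult_trivial_Int[OF Q(1) H QH], of "(g [^] i, h)" "(g [^] j, h')"] *
        by simp
      then show "i = j \<and> h = h'" using g_inj * by blast
    qed
    show "(\<lambda>(i, h). g [^] (i::nat) \<otimes> h) ` ({..<q} \<times> H) = carrier G"
    proof (rule card_subset_eq[OF fin])
      show "(\<lambda>(i, h). g [^] (i::nat) \<otimes> h) ` ({..<q} \<times> H) \<subseteq> carrier G"
        using gc Hc by auto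
      show "card ((\<lambda>(i, h). g [^] (i::nat) \<otimes> h) ` ({..<q} \<times> H)) = card (carrier G)"
        using ord_G by (simp add: card_image[OF inj] card_cartesian_product card_H order_def mult.commute)
    qed
  qed
  have large: "order G < card Q * card Q" using ord_G pq q0 Q(2) by simp
  have "\<exists>k<q. h \<otimes> g = g [^] k \<otimes> h" if h: "h \<in> H" for h
  proof -
    have "h \<otimes> g \<otimes> inv h \<in> Q"
      by (rule large_prime_subgroup_conjugate[OF fin Q(1) prQ large Hc[OF h] g(1)])
    then obtain k where k: "k < q" "h \<otimes> g \<otimes> inv h = g [^] k" using Qpow(2) by blast
    have "g [^] k \<otimes> h = h \<otimes> g"
      unfolding k(2)[symmetric] using gc Hc[OF h] by (simp add: m_assoc)
    then show ?thesis using k(1) by auto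
  qed
  then obtain \<chi> where \<chi>: "\<And>h. h \<in> H \<Longrightarrow> \<chi> h < q \<and> h \<otimes> g = g [^] (\<chi> h :: nat) \<otimes> h" by metis
  have inj_\<chi>: "inj_on \<chi> H"
  proof (rule inj_onI, rule ccontr)
    fix h h' assume h: "h \<in> H" "h' \<in> H" "\<chi> h = \<chi> h'" "h \<noteq> h'"
    \<comment> \<open>Since h and h' act alike on g, this nontrivial element of H commutes with g.
      It generates H by primality of p, so all of G consists of products of powers of g and
      z.\<close>
    define z where "z = inv h' \<otimes> h"
    have c: "h \<in> carrier G" "h' \<in> carrier G" using Hc h by auto
    have z: "z \<in> H" unfolding z_def using h H by (auto intro: subgroup.m_closed subgroup.m_inv_closed)
    have zc: "z \<in> carrier G" using Hc[OF z] .
    have hz: "h = h' \<otimes> z" using c by (simp add: z_def m_assoc[symmetric])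
    have "z \<noteq> \<one>" using hz c h(4) by auto
    have "h' \<otimes> (z \<otimes> g) = h \<otimes> g" using c zc gc by (simp add: hz m_assoc)
    also have "\<dots> = g [^] \<chi> h' \<otimes> h" using \<chi>[OF h(1)] h(3) by simp
    also have "\<dots> = h' \<otimes> g \<otimes> z" using \<chi>[OF h(2)] c zc gc by (simp add: hz m_assoc[symmetric])
    finally have zg: "z \<otimes> g = g \<otimes> z" using c zc gc by (simp add: m_assoc)
    have Hpow: "\<exists>k. h = z [^] (k::nat)" if "h \<in> H" for h
      using that prime_subgroup_eq_powers(2)[OF H _ fin z \<open>z \<noteq> \<one>\<close>] card_H p by blast
    have zgpow: "z [^] k \<otimes> g [^] j = g [^] j \<otimes> z [^] k" for k j :: nat
      using group_commutes_pow[OF group_commutes_pow[OF zg zc gc, symmetric], of k j] zc gc by simp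
    have mult: "(g [^] i \<otimes> z [^] k) \<otimes> (g [^] j \<otimes> z [^] l) = g [^] (i + j) \<otimes> z [^] (k + l)"
      for i j k l :: nat
    proof -
      have "(g [^] i \<otimes> z [^] k) \<otimes> (g [^] j \<otimes> z [^] l) = g [^] i \<otimes> (z [^] k \<otimes> g [^] j) \<otimes> z [^] l"
        using gc zc by (simp add: m_assoc)
      also have "\<dots> = (g [^] i \<otimes> g [^] j) \<otimes> (z [^] k \<otimes> z [^] l)"
        unfolding zgpow using gc zc by (simp add: m_assoc)
      finally show ?thesis using gc zc by (simp add: nat_pow_mult)
    qed
    have rep: "\<exists>i k. x = g [^] (i::nat) \<otimes> z [^] (k::nat)" if "x \<in> carrier G" for x
    proof -
      have "x \<in> (\<lambda>(i, h). g [^] i \<otimes> h) ` ({..<q} \<times> H)" using decomp that by (simp add: bij_betw_def)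
      then obtain i h where "h \<in> H" "x = g [^] (i::nat) \<otimes> h" by auto
      then show ?thesis using Hpow by blast
    qed
    have "comm_group G"
    proof (rule group_comm_groupI)
      fix x y assume "x \<in> carrier G" "y \<in> carrier G"
      with rep obtain i j k l :: nat where "x = g [^] i \<otimes> z [^] k" "y = g [^] j \<otimes> z [^] l" by metis
      then show "x \<otimes> y = y \<otimes> x" by (simp add: mult add.commute)
    qed
    with nonab show False by simp
  qed
  have "cyclic_semidirect_axioms G H q g \<chi>"
    unfolding cyclic_semidirect_axioms_def
    using q H card_H pq finH gc Qpow(1) decomp \<chi> inj_\<chi> by blast
  then show ?thesis using that cyclic_semidirect.intro[OF group_axioms] by blast
qed

theorem lemma5p3:
  fixes G :: "('a, 'b) monoid_scheme" and H :: "'a set" and p q :: nat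
  assumes "prime p" and "prime q" and "p < q"
    and "group G" and "\<not> comm_group G" and "order G = p * q"
    and "subgroup H G" and "card H = p"
  shows "real (ict G H) =
    1 / (real q - 1) *
      (\<Sum>j \<in> {j \<in> {1..q}. coprime j q}. real p powr (t_num q j + real (k_num q j) - 1))"
proof -
  obtain g \<chi> where "cyclic_semidirect G H q g \<chi>"
    using group.cyclic_semidirect_pq[OF assms(4) assms(1-3,5-8)] .
  then have ict: "ict G H = card (({1..<q} \<rightarrow>\<^sub>E H) // scale_rel q H)"
    by (rule cyclic_semidirect.ict_eq_card_scale_classes)
  note q = \<open>prime q\<close>
  have fin_H: "finite H"
    using \<open>card H = p\<close> prime_gt_0_nat[OF \<open>prime p\<close>] by (simp add: card_ge_0_finite)
  have q1: "1 < q" by (rule prime_gt_1_nat[OF q])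
  \<comment> \<open>The index q itself drops out because q > 1 is not coprime to itself.\<close>
  have idx: "{j \<in> {1..q}. coprime j q} = {1..<q}"
    using q1 prime_coprime_less[OF q] by (auto simp: le_less)
  \<comment> \<open>The real exponents are natural numbers, so \<open>powr\<close> becomes an
    ordinary power and each term counts the functions fixed by the unit j.\<close>
  have "(\<Sum>j\<in>{1..<q}. real p powr (t_num q j + real (k_num q j) - 1)) =
      (\<Sum>j\<in>{1..<q}. real (p ^ ((q - 1) div ord q j)))"
    using prime_gt_0_nat[OF \<open>prime p\<close>]
    by (intro sum.cong) (simp_all only: t_num_prime[OF q] powr_realpow of_nat_0_less_iff of_nat_power)
  also have "\<dots> = real (card (({1..<q} \<rightarrow>\<^sub>E H) // scale_rel q H) * (q - 1))"
    using card_scale_classes[OF q fin_H] \<open>card H = p\<close> by simp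
  also have "\<dots> = real (ict G H) * (real q - 1)"
    using q1 by (simp add: ict of_nat_diff)
  finally show ?thesis using q1 unfolding idx by simp
qed

end
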